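(* Let $(f_i)_{i\in\omega}$ be a computable sequence of elements of $L^1(2^\omega)$. Then there are a $\Pi^0_3$ set $P\subseteq 2^\omega$ and a Martin-Löf null set $N$ such that the set $\{x\in 2^\omega : (f_i(x))_{i} \text{ converges}\}$ and $P$ agree outside $N$ (their symmetric difference is contained in $N$). Similarly, if $f$ is a computable element of $L^1(2^\omega)$, then there are a $\Pi^0_3$ set $P'$ and a Martin-Löf null set $N'$ such that $\{x : (f_i(x))_i \text{ converges to } f(x)\}$ and $P'$ agree outside $N'$.
   Context: $2^\omega$ is Cantor space with the uniform (coin-flipping) measure $\mu$, $\mu([\sigma])=2^{-\mathrm{length}(\sigma)}$, where $[\sigma]$ is the set of sequences extending the finite binary string $\sigma$. A simple function is $\sum_{i<n}a_i 1_{[\sigma_i]}$ with $a_i\in\mathbb Q$. A name of an element of $L^1(2^\omega)$ is a sequence $(g_k)$ of simple functions with $\|g_k-g_j\|_1<2^{-k}$ for all $j\ge k$; an element is computable if it has a computable name, and a computable sequence of elements has names computable uniformly in the index. For such an element $g$ with name $(g_k)$, $g(x)$ is said to be defined when $\lim_k g_k(x)$ exists, and then $g(x)$ denotes this limit. "$(f_i(x))$ converges" includes the requirement that each $f_i(x)$ is defined. A $\Sigma^0_1$ subset of $2^\omega$ is one of the form $\bigcup_i B_i$ for a computable sequence of basic open sets (each $[\sigma]$ or $\emptyset$); $\Pi^0_n$, $\Sigma^0_n$ sets are defined via the arithmetic hierarchy in the usual way (e.g. $\Pi^0_3$ sets are sets defined by $\Pi^0_3$ formulas with a free set variable). A Martin-Löf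 test is a uniformly computable sequence $(G_i)$ of $\Sigma^0_1$ sets with $\mu(G_i)<2^{-i}$; a Martin-Löf null set is a set of the form $\bigcap_i G_i$ for such a test. *)

theory Defs
  imports "HOL-Probability.Probability" "HOL-Library.Nat_Bijection"
begin

subsection \<open>Recursive functions\<close>

text \<open>
  The general recursive functions, as a class of functions on argument lists of a fixed length.
  Every function carries an additional parameter of type \<open>'p\<close>, accessible only through the
  initial functions in \<open>B\<close>.  With \<open>B = {}\<close> these are the ordinary recursive functions of number
  arguments; with \<open>B\<close> containing the characteristic function of a set variable they are the
  recursive functions of number arguments and one set argument.  All functions are total, so
  minimisation is restricted to the regular case.
\<close>

inductive recursive_fun :: "('p \<Rightarrow> nat \<Rightarrow> nat) set \<Rightarrow> nat \<Rightarrow> ('p \<Rightarrow> nat list \<Rightarrow> nat) \<Rightarrow> bool"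
  for B :: "('p \<Rightarrow> nat \<Rightarrow> nat) set"
where
  initial: "b \<in> B \<Longrightarrow> recursive_fun B 1 (\<lambda>p ns. b p (ns ! 0))"
| zero: "recursive_fun B n (\<lambda>p ns. 0)"
| succ: "recursive_fun B 1 (\<lambda>p ns. Suc (ns ! 0))"
| proj: "i < n \<Longrightarrow> recursive_fun B n (\<lambda>p ns. ns ! i)"
| comp: "recursive_fun B (length gs) f \<Longrightarrow> (\<forall>g\<in>set gs. recursive_fun B n g) \<Longrightarrow>
    recursive_fun B n (\<lambda>p ns. f p (map (\<lambda>g. g p ns) gs))"
| prim_rec: "recursive_fun B n f \<Longrightarrow> recursive_fun B (Suc (Suc n)) g \<Longrightarrow>
    recursive_fun B (Suc n)
      (\<lambda>p ns. rec_nat (f p (tl ns)) (\<lambda>y r. g p (y # r # tl ns)) (hd ns))"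
| minim: "recursive_fun B (Suc n) f \<Longrightarrow> (\<forall>p ns. length ns = n \<longrightarrow> (\<exists>y. f p (y # ns) = 0)) \<Longrightarrow>
    recursive_fun B n (\<lambda>p ns. LEAST y. f p (y # ns) = 0)"

definition computable1 :: "(nat \<Rightarrow> nat) \<Rightarrow> bool" where
  "computable1 c \<longleftrightarrow> (\<exists>f. recursive_fun {} 1 f \<and> (\<forall>k. c k = f () [k]))"

definition computable2 :: "(nat \<Rightarrow> nat \<Rightarrow> nat) \<Rightarrow> bool" where
  "computable2 c \<longleftrightarrow> (\<exists>f. recursive_fun {} 2 f \<and> (\<forall>i k. c i k = f () [i, k]))"


subsection \<open>Cantor space\<close>

type_synonym cantor = "nat \<Rightarrow> bool"

definition coin_measure :: "cantor measure" where
  "coin_measure = Pi\<^sub>M UNIV (\<lambda>_. measure_pmf (bernoulli_pmf (1/2)))"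

definition cylinder :: "bool list \<Rightarrow> cantor set" where
  "cylinder s = {x. \<forall>i<length s. x i = s ! i}"

lemma emeasure_cylinder: "emeasure coin_measure (cylinder s) = ennreal ((1/2) ^ length s)"
proof -
  interpret product_prob_space "\<lambda>_::nat. measure_pmf (bernoulli_pmf (1/2))" UNIV
    by unfold_locales
  have eq: "cylinder s =
      prod_emb UNIV (\<lambda>_. measure_pmf (bernoulli_pmf (1/2))) {..<length s}
        (Pi\<^sub>E {..<length s} (\<lambda>i. {s ! i}))"
    by (auto simp: cylinder_def prod_emb_def PiE_def Pi_def)
  have half: "emeasure (measure_pmf (bernoulli_pmf (1/2))) {b} = ennreal (1/2)" for b
    by (cases b) (simp_all add: emeasure_pmf_single)
  show ?thesis
    unfolding eq coin_measure_def
    by (subst emeasure_PiM_emb)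
      (simp_all only: half prod_constant card_lessThan ennreal_power, simp_all)
qed


subsection \<open>Effective codes\<close>

text \<open>
  Finite objects are coded by numbers through surjective decodings built from the computable
  bijections \<^const>\<open>prod_decode\<close>, \<^const>\<open>list_decode\<close> and \<^const>\<open>int_decode\<close>.
\<close>

definition string_of :: "nat \<Rightarrow> bool list" where
  "string_of n = map (\<lambda>b. b \<noteq> 0) (list_decode n)"

definition rat_of :: "nat \<Rightarrow> rat" where
  "rat_of n = (case prod_decode n of (p, q) \<Rightarrow> of_int (int_decode p) / of_nat (Suc q))"

definition terms_of :: "nat \<Rightarrow> (rat \<times> bool list) list" where
  "terms_of n = map (\<lambda>t. case prod_decode t of (a, s) \<Rightarrow> (rat_of a, string_of s)) (list_decode n)"

fun basic_open :: "nat \<Rightarrow> cantor set" where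
  "basic_open 0 = {}"
| "basic_open (Suc s) = cylinder (string_of s)"

lemma surj_string_of: "surj string_of"
proof (rule surjI)
  show "string_of (list_encode (map of_bool s)) = s" for s
    by (simp add: string_of_def comp_def)
qed

lemma surj_rat_of: "surj rat_of"
proof
  show "UNIV \<subseteq> range rat_of"
  proof
    fix r :: rat
    obtain p q where r: "r = Fract p q" and q: "q > 0"
      by (cases r) auto
    have s: "Suc (nat (q - 1)) = nat q"
      using q by simp
    have "rat_of (prod_encode (int_encode p, nat (q - 1))) = of_int p / of_nat (nat q)"
      unfolding rat_of_def by (simp only: prod_encode_inverse int_encode_inverse prod.case s)
    also have "\<dots> = r"
      using q by (simp add: r Fract_of_int_quotient)
    finally show "r \<in> range rat_of"
      by (metis rangeI)
  qed
qed simp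

lemma surj_terms_of: "surj terms_of"
proof (rule surjI)
  fix ts :: "(rat \<times> bool list) list"
  show "terms_of (list_encode
      (map (\<lambda>(a, s). prod_encode (inv rat_of a, inv string_of s)) ts)) = ts"
    by (induction ts)
      (auto simp: terms_of_def surj_f_inv_f[OF surj_rat_of] surj_f_inv_f[OF surj_string_of])
qed


subsection \<open>Elements of \<open>L\<^sup>1\<close> and their names\<close>

definition simple_fun :: "(rat \<times> bool list) list \<Rightarrow> cantor \<Rightarrow> real" where
  "simple_fun ts x = (\<Sum>(a, s)\<leftarrow>ts. of_rat a * indicator (cylinder s) x)"

definition L1_norm :: "(cantor \<Rightarrow> real) \<Rightarrow> real" where
  "L1_norm h = (\<integral>x. \<bar>h x\<bar> \<partial>coin_measure)"

definition L1_name :: "(nat \<Rightarrow> cantor \<Rightarrow> real) \<Rightarrow> bool" where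
  "L1_name g \<longleftrightarrow> (\<forall>k. g k \<in> range simple_fun) \<and>
     (\<forall>k j. j \<ge> k \<longrightarrow> L1_norm (\<lambda>x. g k x - g j x) < (1/2) ^ k)"

text \<open>An element of \<open>L\<^sup>1\<close> is given by an integrable representative \<open>h\<close>.\<close>

definition L1_name_of :: "(nat \<Rightarrow> cantor \<Rightarrow> real) \<Rightarrow> (cantor \<Rightarrow> real) \<Rightarrow> bool" where
  "L1_name_of g h \<longleftrightarrow> L1_name g \<and> integrable coin_measure h \<and>
     (\<lambda>k. L1_norm (\<lambda>x. g k x - h x)) \<longlonglongrightarrow> 0"

definition computable_name :: "(nat \<Rightarrow> cantor \<Rightarrow> real) \<Rightarrow> bool" where
  "computable_name g \<longleftrightarrow> (\<exists>c. computable1 c \<and> (\<forall>k. g k = simple_fun (terms_of (c k))))"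

definition uniformly_computable_names :: "(nat \<Rightarrow> nat \<Rightarrow> cantor \<Rightarrow> real) \<Rightarrow> bool" where
  "uniformly_computable_names F \<longleftrightarrow>
     (\<exists>c. computable2 c \<and> (\<forall>i k. F i k = simple_fun (terms_of (c i k))))"

text \<open>Pointwise evaluation depends on the name and not only on the element it names.\<close>

definition defined_at :: "(nat \<Rightarrow> cantor \<Rightarrow> real) \<Rightarrow> cantor \<Rightarrow> bool" where
  "defined_at g x \<longleftrightarrow> convergent (\<lambda>k. g k x)"

definition value_at :: "(nat \<Rightarrow> cantor \<Rightarrow> real) \<Rightarrow> cantor \<Rightarrow> real" where
  "value_at g x = lim (\<lambda>k. g k x)"


subsection \<open>Arithmetical sets and Martin-Loef null sets\<close>

text \<open>
  A relation of number arguments and a set argument is computable if its characteristic function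
  is recursive; the arithmetical hierarchy consists of alternating number quantifier prefixes
  over computable relations.
\<close>

definition computable_rel :: "nat \<Rightarrow> (cantor \<Rightarrow> nat list \<Rightarrow> bool) \<Rightarrow> bool" where
  "computable_rel n R \<longleftrightarrow> (\<exists>f. recursive_fun {\<lambda>x m. of_bool (x m)} n f \<and>
     (\<forall>x ns. length ns = n \<longrightarrow> f x ns = of_bool (R x ns)))"

fun Sigma0_rel :: "nat \<Rightarrow> nat \<Rightarrow> (cantor \<Rightarrow> nat list \<Rightarrow> bool) \<Rightarrow> bool"
  and Pi0_rel :: "nat \<Rightarrow> nat \<Rightarrow> (cantor \<Rightarrow> nat list \<Rightarrow> bool) \<Rightarrow> bool"
where
  "Sigma0_rel 0 n R \<longleftrightarrow> computable_rel n R"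
| "Sigma0_rel (Suc m) n R \<longleftrightarrow>
     (\<exists>S. Pi0_rel m (Suc n) S \<and> (\<forall>x ns. length ns = n \<longrightarrow> R x ns = (\<exists>k. S x (k # ns))))"
| "Pi0_rel 0 n R \<longleftrightarrow> computable_rel n R"
| "Pi0_rel (Suc m) n R \<longleftrightarrow>
     (\<exists>S. Sigma0_rel m (Suc n) S \<and> (\<forall>x ns. length ns = n \<longrightarrow> R x ns = (\<forall>k. S x (k # ns))))"

definition Pi0_set :: "nat \<Rightarrow> cantor set \<Rightarrow> bool" where
  "Pi0_set m P \<longleftrightarrow> Pi0_rel m 0 (\<lambda>x _. x \<in> P)"

lemma Pi0_set_3_iff:
  "Pi0_set 3 P \<longleftrightarrow> (\<exists>R. computable_rel 3 R \<and> P = {x. \<forall>i. \<exists>j. \<forall>k. R x [k, j, i]})"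
  (is "?L \<longleftrightarrow> ?R")
proof
  assume ?L
  then obtain S T R where "computable_rel 3 R"
    and "\<forall>x. (x \<in> P) = (\<forall>i. S x [i])"
    and "\<forall>x ns. length ns = 1 \<longrightarrow> S x ns = (\<exists>j. T x (j # ns))"
    and "\<forall>x ns. length ns = 2 \<longrightarrow> T x ns = (\<forall>k. R x (k # ns))"
    by (auto simp: Pi0_set_def eval_nat_numeral)
  then have "computable_rel 3 R \<and> P = {x. \<forall>i. \<exists>j. \<forall>k. R x [k, j, i]}"
    by auto
  then show ?R
    by blast
next
  assume ?R
  then obtain R where R: "computable_rel 3 R" and P: "P = {x. \<forall>i. \<exists>j. \<forall>k. R x [k, j, i]}"
    by blast
  have "Pi0_rel 1 2 (\<lambda>x ns. \<forall>k. R x (k # ns))"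
    using R by (auto simp: eval_nat_numeral)
  then have "Sigma0_rel 2 1 (\<lambda>x ns. \<exists>j. \<forall>k. R x (k # j # ns))"
    unfolding numeral_2_eq_2 One_nat_def Sigma0_rel.simps(2) by blast
  then have "Pi0_rel 3 0 (\<lambda>x ns. \<forall>i. \<exists>j. \<forall>k. R x (k # j # i # ns))"
    unfolding numeral_3_eq_3 numeral_2_eq_2 One_nat_def Pi0_rel.simps(2)[of "Suc (Suc 0)"]
    by blast
  then show ?L
    by (auto simp: Pi0_set_def P eval_nat_numeral)
qed

definition uniformly_Sigma01 :: "(nat \<Rightarrow> cantor set) \<Rightarrow> bool" where
  "uniformly_Sigma01 G \<longleftrightarrow> (\<exists>b. computable2 b \<and> (\<forall>i. G i = (\<Union>j. basic_open (b i j))))"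

definition martin_loef_test :: "(nat \<Rightarrow> cantor set) \<Rightarrow> bool" where
  "martin_loef_test G \<longleftrightarrow> uniformly_Sigma01 G \<and> (\<forall>i. measure coin_measure (G i) < (1/2) ^ i)"

definition martin_loef_null :: "cantor set \<Rightarrow> bool" where
  "martin_loef_null N \<longleftrightarrow> (\<exists>G. martin_loef_test G \<and> N = (\<Inter>i. G i))"

definition agree_outside :: "cantor set \<Rightarrow> cantor set \<Rightarrow> cantor set \<Rightarrow> bool" where
  "agree_outside N A P \<longleftrightarrow> (A - P) \<union> (P - A) \<subseteq> N"

end

theory Submission
  imports Defs
begin

text \<open>
  Let \<open>S(x)\<close> be the sum over all \<open>i\<close> and all \<open>k \<ge> i\<close> of \<open>\<bar>F i (k+1) x - F i k x\<bar>\<close>.  The rate in the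
  definition of a name gives \<open>\<integral>S \<le> 4\<close>, so by Markov's inequality the sets \<open>{S > 2\<^bsup>m+3\<^esup>}\<close> form a
  Martin-Loef test.  Where \<open>S\<close> is finite, every \<open>f\<^sub>i(x)\<close> is defined and \<open>f\<^sub>i(x) - F i i x\<close> tends
  to \<open>0\<close>, so \<open>(f\<^sub>i(x))\<close> converges iff the sequence \<open>(F i i x)\<close> of rationals, computable
  from \<open>x\<close>, is Cauchy, and this is a \<open>\<Pi>\<^sup>0\<^sub>3\<close> condition.  Convergence to \<open>f(x)\<close> is convergence of the
  interleaved sequence \<open>f\<^sub>0, f, f\<^sub>1, f, \<dots>\<close> at \<open>x\<close>.
\<close>

subsection \<open>Closure properties of recursive functions\<close>

text \<open>
  Every \<^const>\<open>recursive_fun\<close> also has junk values on lists of the wrong length;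
  \<open>rec_fun B n\<close> ignores them.
\<close>

definition rec_fun :: "('p \<Rightarrow> nat \<Rightarrow> nat) set \<Rightarrow> nat \<Rightarrow> ('p \<Rightarrow> nat list \<Rightarrow> nat) \<Rightarrow> bool" where
  "rec_fun B n f \<longleftrightarrow> (\<exists>g. recursive_fun B n g \<and> (\<forall>p ns. length ns = n \<longrightarrow> f p ns = g p ns))"

abbreviation rec_rel :: "('p \<Rightarrow> nat \<Rightarrow> nat) set \<Rightarrow> nat \<Rightarrow> ('p \<Rightarrow> nat list \<Rightarrow> bool) \<Rightarrow> bool" where
  "rec_rel B n P \<equiv> rec_fun B n (\<lambda>p ns. of_bool (P p ns))"

section \<open>Composition, substitution of variables and primitive recursion\<close>

lemma rec_fun_cong:
  assumes "rec_fun B n f" "\<And>p ns. length ns = n \<Longrightarrow> f p ns = g p ns"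
  shows "rec_fun B n g"
  using assms unfolding rec_fun_def by metis

lemma rec_fun_comp:
  assumes "rec_fun B (length gs) f" "\<And>g. g \<in> set gs \<Longrightarrow> rec_fun B n g"
  shows "rec_fun B n (\<lambda>p ns. f p (map (\<lambda>g. g p ns) gs))"
proof -
  obtain f' where f': "recursive_fun B (length gs) f'"
    "\<And>p ns. length ns = length gs \<Longrightarrow> f p ns = f' p ns"
    using assms(1) unfolding rec_fun_def by blast
  have "\<forall>g\<in>set gs. \<exists>h. recursive_fun B n h \<and> (\<forall>p ns. length ns = n \<longrightarrow> g p ns = h p ns)"
    using assms(2) unfolding rec_fun_def by blast
  then obtain h where h: "\<forall>g\<in>set gs. recursive_fun B n (h g) \<and>
      (\<forall>p ns. length ns = n \<longrightarrow> g p ns = h g p ns)"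
    by metis
  have "recursive_fun B n (\<lambda>p ns. f' p (map (\<lambda>g. g p ns) (map h gs)))"
    using h f'(1) by (intro comp) auto
  moreover have "f p (map (\<lambda>g. g p ns) gs) = f' p (map (\<lambda>g. g p ns) (map h gs))"
    if "length ns = n" for p ns
  proof -
    have "map (\<lambda>g. g p ns) gs = map (\<lambda>g. g p ns) (map h gs)"
      using h that by simp
    then show ?thesis
      using f'(2) by (metis length_map)
  qed
  ultimately show ?thesis
    unfolding rec_fun_def by blast
qed

lemma rec_fun_comp1:
  assumes "rec_fun B 1 (\<lambda>p ns. f p (ns ! 0))" "rec_fun B n g"
  shows "rec_fun B n (\<lambda>p ns. f p (g p ns))"
  using rec_fun_comp[of B "[g]" "\<lambda>p ns. f p (ns ! 0)" n] assms by simp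

lemma rec_fun_comp2:
  assumes "rec_fun B 2 (\<lambda>p ns. f p (ns ! 0) (ns ! 1))" "rec_fun B n g" "rec_fun B n h"
  shows "rec_fun B n (\<lambda>p ns. f p (g p ns) (h p ns))"
  using rec_fun_comp[of B "[g, h]" "\<lambda>p ns. f p (ns ! 0) (ns ! 1)" n] assms
  by (auto simp: numeral_2_eq_2)

lemma rec_fun_nth: "i < n \<Longrightarrow> rec_fun B n (\<lambda>p ns. ns ! i)"
  unfolding rec_fun_def using proj by blast

text \<open>Under a binder the bound variable is \<open>ns ! 0\<close> and the parameters sit in
  \<open>tl ns\<close>; this rule and the next recognise variables under one and two
  binders.\<close>

lemma rec_fun_nth_tl: "Suc i < n \<Longrightarrow> rec_fun B n (\<lambda>p ns. tl ns ! i)"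
  by (rule rec_fun_cong[OF rec_fun_nth[of "Suc i"]]) (auto simp: nth_tl)

lemma rec_fun_nth_tl_tl: "Suc (Suc i) < n \<Longrightarrow> rec_fun B n (\<lambda>p ns. tl (tl ns) ! i)"
  by (rule rec_fun_cong[OF rec_fun_nth[of "Suc (Suc i)"]]) (auto simp: nth_tl)

lemma rec_fun_reindex:
  assumes "rec_fun B m f" "\<And>i. i < m \<Longrightarrow> \<sigma> i < n"
  shows "rec_fun B n (\<lambda>p ns. f p (map (\<lambda>i. ns ! \<sigma> i) [0..<m]))"
proof -
  have "rec_fun B n (\<lambda>p ns. f p (map (\<lambda>g. g p ns) (map (\<lambda>i p ns. ns ! \<sigma> i) [0..<m])))"
    using assms by (intro rec_fun_comp) (auto intro: rec_fun_nth)
  then show ?thesis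
    by (simp add: comp_def)
qed

lemma rec_fun_tl:
  assumes "rec_fun B n f"
  shows "rec_fun B (Suc n) (\<lambda>p ns. f p (tl ns))"
proof (rule rec_fun_cong[OF rec_fun_reindex[OF assms, of Suc "Suc n"]])
  show "f p (map (\<lambda>i. ns ! Suc i) [0..<n]) = f p (tl ns)" if "length ns = Suc n" for p ns
  proof -
    have "map (\<lambda>i. ns ! Suc i) [0..<n] = tl ns"
      using that by (intro nth_equalityI) (auto simp: nth_tl)
    then show ?thesis by simp
  qed
qed simp

lemma rec_fun_0: "rec_fun B n (\<lambda>p ns. 0)"
  unfolding rec_fun_def using zero by blast

lemma rec_fun_Suc:
  assumes "rec_fun B n f"
  shows "rec_fun B n (\<lambda>p ns. Suc (f p ns))"
proof -
  have "rec_fun B 1 (\<lambda>p ns. Suc (ns ! 0))"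
    unfolding rec_fun_def using succ by blast
  from rec_fun_comp1[OF this assms] show ?thesis .
qed

lemma rec_fun_const: "rec_fun B n (\<lambda>p ns. c)"
  by (induction c) (auto intro: rec_fun_0 rec_fun_Suc)

text \<open>The basic scheme recurses on the head of its argument list; composing it with
  \<open>b\<close> and the \<open>n\<close> projections allows any recursive bound. In the last
  hypothesis the counter and the previous value stand in front of the parameters.\<close>

lemma rec_fun_rec_nat:
  assumes "rec_fun B n b" "rec_fun B n f"
    and "rec_fun B (Suc (Suc n)) (\<lambda>p ns. g p (tl (tl ns)) (ns ! 0) (ns ! 1))"
  shows "rec_fun B n (\<lambda>p ns. rec_nat (f p ns) (g p ns) (b p ns))"
proof -
  obtain f' where f': "recursive_fun B n f'" "\<And>p ns. length ns = n \<Longrightarrow> f p ns = f' p ns"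
    using assms(2) unfolding rec_fun_def by blast
  obtain g' where g': "recursive_fun B (Suc (Suc n)) g'"
    "\<And>p ns. length ns = Suc (Suc n) \<Longrightarrow> g p (tl (tl ns)) (ns ! 0) (ns ! 1) = g' p ns"
    using assms(3) unfolding rec_fun_def by blast
  have g'': "g p ns = (\<lambda>y r. g' p (y # r # ns))" if "length ns = n" for p ns
    using g'(2)[of "_ # _ # ns" p] that by (intro ext) simp
  let ?r = "\<lambda>p ns. rec_nat (f' p (tl ns)) (\<lambda>y r. g' p (y # r # tl ns)) (hd ns)"
  have "recursive_fun B (Suc n) ?r"
    by (intro prim_rec f' g')
  then have r: "rec_fun B (length (b # map (\<lambda>i p ns. ns ! i) [0..<n])) ?r"
    unfolding rec_fun_def by auto
  have "rec_fun B n (\<lambda>p ns. ?r p (map (\<lambda>g. g p ns) (b # map (\<lambda>i p ns. ns ! i) [0..<n])))"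
    using assms(1) by (intro rec_fun_comp r) (auto intro: rec_fun_nth)
  then show ?thesis
  proof (rule rec_fun_cong)
    fix p :: 'a and ns :: "nat list"
    assume n: "length ns = n"
    then have "map (\<lambda>i. ns ! i) [0..<n] = ns"
      using map_nth by blast
    then show "?r p (map (\<lambda>g. g p ns) (b # map (\<lambda>i p ns. ns ! i) [0..<n])) =
        rec_nat (f p ns) (g p ns) (b p ns)"
      using n by (simp add: comp_def f'(2) g'')
  qed
qed

section \<open>Arithmetic, bounded sums and bounded products\<close>

lemma rec_fun_add:
  assumes "rec_fun B n f" "rec_fun B n g"
  shows "rec_fun B n (\<lambda>p ns. f p ns + g p ns)"
proof -
  have "rec_fun B n (\<lambda>p ns. rec_nat (f p ns) (\<lambda>y r. Suc r) (g p ns))"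
    by (intro rec_fun_rec_nat rec_fun_Suc assms rec_fun_nth) simp
  moreover have "rec_nat a (\<lambda>y r. Suc r) b = a + b" for a b
    by (induction b) auto
  ultimately show ?thesis by simp
qed

lemma rec_fun_diff:
  assumes "rec_fun B n f" "rec_fun B n g"
  shows "rec_fun B n (\<lambda>p ns. f p ns - g p ns)"
proof -
  \<comment> \<open>The inner recursion is the predecessor, with value 0 at 0; iterating it gives
    truncated subtraction.\<close>
  have "rec_fun B n (\<lambda>p ns. rec_nat (f p ns) (\<lambda>y r. rec_nat 0 (\<lambda>z q. z) r) (g p ns))"
    by (intro rec_fun_rec_nat rec_fun_const assms rec_fun_nth) simp_all
  moreover have "rec_nat a (\<lambda>y r. rec_nat 0 (\<lambda>z q. z) r) b = a - b" for a b
  proof (induction b)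
    case (Suc b)
    have "rec_nat 0 (\<lambda>z q. z) m = m - 1" for m :: nat
      by (cases m) auto
    with Suc show ?case by simp
  qed simp
  ultimately show ?thesis by simp
qed

lemma rec_fun_mult:
  assumes "rec_fun B n f" "rec_fun B n g"
  shows "rec_fun B n (\<lambda>p ns. f p ns * g p ns)"
proof -
  have "rec_fun B n (\<lambda>p ns. rec_nat 0 (\<lambda>y r. r + f p ns) (g p ns))"
    by (intro rec_fun_rec_nat rec_fun_const assms rec_fun_nth rec_fun_add rec_fun_tl) simp
  moreover have "rec_nat 0 (\<lambda>y r. r + a) b = a * b" for a b :: nat
    by (induction b) auto
  ultimately show ?thesis by simp
qed

text \<open>The body of a binder over \<open>y\<close> is a function of one more argument, placed in front.\<close>

lemma rec_fun_skip_second: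
  assumes "rec_fun B (Suc n) (\<lambda>p ns. f p (tl ns) (ns ! 0))"
  shows "rec_fun B (Suc (Suc n)) (\<lambda>p ns. f p (tl (tl ns)) (ns ! 0))"
proof (rule rec_fun_cong[OF rec_fun_reindex[OF assms, of "\<lambda>i. if i = 0 then 0 else Suc i"]])
  fix p :: 'a and ns :: "nat list"
  assume "length ns = Suc (Suc n)"
  then obtain a b ms where ns: "ns = a # b # ms" "length ms = n"
    by (auto simp: length_Suc_conv)
  have "map (\<lambda>i. ns ! (if i = 0 then 0 else Suc i)) [0..<Suc n] = a # ms"
    using ns(2) by (intro nth_equalityI) (auto simp: ns(1) nth_Cons' simp del: upt_Suc)
  then show "f p (tl (map (\<lambda>i. ns ! (if i = 0 then 0 else Suc i)) [0..<Suc n]))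
      (map (\<lambda>i. ns ! (if i = 0 then 0 else Suc i)) [0..<Suc n] ! 0) = f p (tl (tl ns)) (ns ! 0)"
    by (simp add: ns(1) del: upt_Suc)
qed auto

lemma rec_fun_sum:
  assumes "rec_fun B n b" "rec_fun B (Suc n) (\<lambda>p ns. f p (tl ns) (ns ! 0))"
  shows "rec_fun B n (\<lambda>p ns. \<Sum>y<b p ns. f p ns y)"
proof -
  have "rec_fun B n (\<lambda>p ns. rec_nat 0 (\<lambda>y r. r + f p ns y) (b p ns))"
    by (intro rec_fun_rec_nat rec_fun_const assms rec_fun_nth rec_fun_add rec_fun_skip_second) simp
  moreover have "rec_nat 0 (\<lambda>y r. r + h y) b = (\<Sum>y<b. h y)" for h :: "nat \<Rightarrow> nat" and b
    by (induction b) auto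
  ultimately show ?thesis by (simp only:)
qed

lemma rec_fun_prod:
  assumes "rec_fun B n b" "rec_fun B (Suc n) (\<lambda>p ns. f p (tl ns) (ns ! 0))"
  shows "rec_fun B n (\<lambda>p ns. \<Prod>y<b p ns. f p ns y)"
proof -
  have "rec_fun B n (\<lambda>p ns. rec_nat 1 (\<lambda>y r. r * f p ns y) (b p ns))"
    by (intro rec_fun_rec_nat rec_fun_const assms rec_fun_nth rec_fun_mult rec_fun_skip_second) simp
  moreover have "rec_nat 1 (\<lambda>y r. r * h y) b = (\<Prod>y<b. h y)" for h :: "nat \<Rightarrow> nat" and b
    by (induction b) auto
  ultimately show ?thesis by (simp only:)
qed

lemma rec_fun_power:
  assumes "rec_fun B n f" "rec_fun B n g"
  shows "rec_fun B n (\<lambda>p ns. f p ns ^ g p ns)"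
  using rec_fun_prod[OF assms(2) rec_fun_tl[OF assms(1)]] by simp

section \<open>Decidable relations, definition by cases and bounded quantifiers\<close>

lemma rec_rel_not:
  assumes "rec_rel B n P"
  shows "rec_rel B n (\<lambda>p ns. \<not> P p ns)"
proof -
  have "rec_fun B n (\<lambda>p ns. 1 - of_bool (P p ns))"
    by (intro rec_fun_diff rec_fun_const assms)
  then show ?thesis
    by (rule rec_fun_cong) simp
qed

lemma rec_rel_conj:
  assumes "rec_rel B n P" "rec_rel B n Q"
  shows "rec_rel B n (\<lambda>p ns. P p ns \<and> Q p ns)"
  by (rule rec_fun_cong[OF rec_fun_mult[OF assms]]) simp

lemma rec_rel_imp:
  assumes "rec_rel B n P" "rec_rel B n Q"
  shows "rec_rel B n (\<lambda>p ns. P p ns \<longrightarrow> Q p ns)"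
  by (rule rec_fun_cong[OF rec_rel_not[OF rec_rel_conj[OF assms(1) rec_rel_not[OF assms(2)]]]])
    auto

lemma rec_rel_iff:
  assumes "rec_rel B n P" "rec_rel B n Q"
  shows "rec_rel B n (\<lambda>p ns. P p ns \<longleftrightarrow> Q p ns)"
  by (rule rec_fun_cong[OF rec_rel_conj[OF rec_rel_imp[OF assms] rec_rel_imp[OF assms(2,1)]]])
    auto

lemma rec_rel_le:
  assumes "rec_fun B n f" "rec_fun B n g"
  shows "rec_rel B n (\<lambda>p ns. f p ns \<le> g p ns)"
proof -
  \<comment> \<open>The truncated difference is 0 exactly when
    \<open>f p ns \<le> g p ns\<close>.\<close>
  have "rec_fun B n (\<lambda>p ns. 1 - (f p ns - g p ns))"
    by (intro rec_fun_diff rec_fun_const assms)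
  then show ?thesis
    by (rule rec_fun_cong) auto
qed

lemma rec_rel_less:
  assumes "rec_fun B n f" "rec_fun B n g"
  shows "rec_rel B n (\<lambda>p ns. f p ns < g p ns)"
  using rec_rel_not[OF rec_rel_le[OF assms(2,1)]] by (simp add: not_le)

lemma rec_rel_eq:
  assumes "rec_fun B n f" "rec_fun B n g"
  shows "rec_rel B n (\<lambda>p ns. f p ns = g p ns)"
  using rec_rel_conj[OF rec_rel_le[OF assms] rec_rel_le[OF assms(2,1)]]
  by (rule rec_fun_cong) auto

lemma rec_fun_if:
  assumes "rec_rel B n P" "rec_fun B n f" "rec_fun B n g"
  shows "rec_fun B n (\<lambda>p ns. if P p ns then f p ns else g p ns)"
proof -
  have "rec_fun B n (\<lambda>p ns. of_bool (P p ns) * f p ns + of_bool (\<not> P p ns) * g p ns)"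
    by (intro rec_fun_add rec_fun_mult rec_rel_not assms)
  then show ?thesis
    by (rule rec_fun_cong) simp
qed

lemma rec_rel_ball:
  assumes "rec_fun B n b" "rec_rel B (Suc n) (\<lambda>p ns. P p (tl ns) (ns ! 0))"
  shows "rec_rel B n (\<lambda>p ns. \<forall>y<b p ns. P p ns y)"
proof (rule rec_fun_cong[OF rec_fun_prod[OF assms]])
  show "(\<Prod>y<b p ns. of_bool (P p ns y)) = (of_bool (\<forall>y<b p ns. P p ns y) :: nat)" for p ns
    by (cases "\<forall>y<b p ns. P p ns y") auto
qed

lemmas rec_intros =
  rec_fun_nth rec_fun_nth_tl rec_fun_nth_tl_tl rec_fun_const rec_fun_Suc rec_fun_add rec_fun_diff
  rec_fun_mult rec_fun_sum rec_fun_prod rec_fun_power rec_fun_if rec_rel_not rec_rel_conj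
  rec_rel_imp rec_rel_iff rec_rel_le rec_rel_less rec_rel_eq rec_rel_ball

lemma rec_fun_div2:
  assumes "rec_fun B n f"
  shows "rec_fun B n (\<lambda>p ns. f p ns div 2)"
proof -
  \<comment> \<open>Halving is a count: the \<open>y\<close> with \<open>2 * y + 2 \<le> m\<close>
    are exactly those below \<open>m div 2\<close>.\<close>
  have "rec_fun B n (\<lambda>p ns. \<Sum>y<f p ns. of_bool (2 * y + 2 \<le> f p ns))"
    by (intro rec_intros assms rec_fun_tl[OF assms]) simp_all
  then show ?thesis
  proof (rule rec_fun_cong)
    fix p ns
    have "{y. y < f p ns \<and> 2 * y + 2 \<le> f p ns} = {..<f p ns div 2}"
      by auto
    then show "(\<Sum>y<f p ns. of_bool (2 * y + 2 \<le> f p ns)) = f p ns div 2"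
      by (simp add: of_bool_def sum.If_cases lessThan_def Int_def)
  qed
qed

lemma rec_rel_even:
  assumes "rec_fun B n f"
  shows "rec_rel B n (\<lambda>p ns. even (f p ns))"
proof -
  have "rec_rel B n (\<lambda>p ns. 2 * (f p ns div 2) = f p ns)"
    by (intro rec_intros rec_fun_div2 assms)
  moreover have "2 * (m div 2) = m \<longleftrightarrow> even m" for m :: nat
    by presburger
  ultimately show ?thesis
    by (simp only:)
qed


subsection \<open>Recursive decoding of lists and strings\<close>

text \<open>A nonempty list has code \<open>Suc (prod_encode (x, c))\<close>, with \<open>x\<close>
  its head and \<open>c\<close> the code of its tail, so the predecessor of the code is the pair to
  unpack.\<close>

definition code_tl :: "nat \<Rightarrow> nat" where
  "code_tl n = snd (prod_decode (n - 1))"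

definition code_nth :: "nat \<Rightarrow> nat \<Rightarrow> nat" where
  "code_nth n i = fst (prod_decode ((code_tl ^^ i) n - 1))"

lemma rec_fun_triangle:
  assumes "rec_fun B n f"
  shows "rec_fun B n (\<lambda>p ns. triangle (f p ns))"
proof -
  have "rec_fun B n (\<lambda>p ns. \<Sum>y<Suc (f p ns). y)"
    by (intro rec_intros assms) simp
  moreover have "(\<Sum>y<Suc m. y) = triangle m" for m
    by (induction m) auto
  ultimately show ?thesis by (simp only:)
qed

text \<open>Both components are at most \<open>z\<close>, and \<open>triangle (a + b) + a\<close> is
  the injective pairing function, so a single summand survives. Decoding thereby becomes a bounded
  double sum.\<close>

lemma prod_decode_as_sum:
  "h (prod_decode z) = (\<Sum>a<Suc z. \<Sum>b<Suc z. of_bool (triangle (a + b) + a = z) * (h (a, b) :: nat))"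
proof -
  obtain a b where ab: "prod_decode z = (a, b)"
    by force
  then have z: "z = prod_encode (a, b)"
    by (metis prod_decode_inverse)
  have lt: "a < Suc z" "b < Suc z"
    unfolding z using le_prod_encode_1 le_prod_encode_2 by (simp_all add: less_Suc_eq_le)
  have eq: "triangle (a' + b') + a' = z \<longleftrightarrow> a' = a \<and> b' = b" for a' b'
  proof -
    have "triangle (a' + b') + a' = prod_encode (a', b')"
      by (simp add: prod_encode_def)
    then show ?thesis
      by (simp add: z)
  qed
  have "(\<Sum>a'<Suc z. \<Sum>b'<Suc z. of_bool (triangle (a' + b') + a' = z) * h (a', b')) =
      (\<Sum>a'<Suc z. \<Sum>b'<Suc z. if a' = a then if b' = b then h (a, b) else 0 else 0)"
    unfolding eq by (intro sum.cong) auto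
  also have "\<dots> = (\<Sum>a'<Suc z. if a' = a then h (a, b) else 0)"
    using lt by (intro sum.cong refl) (simp del: sum.lessThan_Suc)
  also have "\<dots> = h (a, b)"
    using lt by (simp del: sum.lessThan_Suc)
  finally show ?thesis
    using ab by simp
qed

lemma rec_fun_fst_prod_decode:
  assumes "rec_fun B n f"
  shows "rec_fun B n (\<lambda>p ns. fst (prod_decode (f p ns)))"
  unfolding prod_decode_as_sum[where h = fst] fst_conv
  by (intro rec_intros rec_fun_triangle assms rec_fun_tl[OF assms]
      rec_fun_tl[OF rec_fun_tl[OF assms]]) simp_all

lemma rec_fun_snd_prod_decode:
  assumes "rec_fun B n f"
  shows "rec_fun B n (\<lambda>p ns. snd (prod_decode (f p ns)))"
  unfolding prod_decode_as_sum[where h = snd] snd_conv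
  by (intro rec_intros rec_fun_triangle assms rec_fun_tl[OF assms]
      rec_fun_tl[OF rec_fun_tl[OF assms]]) simp_all

lemma rec_fun_funpow_code_tl:
  assumes "rec_fun B n f" "rec_fun B n g"
  shows "rec_fun B n (\<lambda>p ns. (code_tl ^^ f p ns) (g p ns))"
proof -
  have "rec_fun B n (\<lambda>p ns. rec_nat (g p ns) (\<lambda>y r. code_tl r) (f p ns))"
    unfolding code_tl_def
    by (intro rec_fun_rec_nat rec_intros rec_fun_snd_prod_decode assms) simp_all
  moreover have "rec_nat a (\<lambda>y r. code_tl r) m = (code_tl ^^ m) a" for a m
    by (induction m) auto
  ultimately show ?thesis by (simp only:)
qed

lemma rec_fun_code_nth:
  assumes "rec_fun B n f" "rec_fun B n g"
  shows "rec_fun B n (\<lambda>p ns. code_nth (f p ns) (g p ns))"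
  unfolding code_nth_def
  by (intro rec_intros rec_fun_fst_prod_decode rec_fun_funpow_code_tl assms)

lemma list_decode_code_tl: "list_decode (code_tl n) = tl (list_decode n)"
proof (cases n)
  case 0
  \<comment> \<open>Truncation makes \<open>0 - 1\<close> equal to 0, so \<open>code_tl\<close>
    fixes 0, in accordance with \<open>tl [] = []\<close>.\<close>
  have "snd (prod_decode 0) \<le> 0"
    using le_prod_encode_2[of "snd (prod_decode 0)" "fst (prod_decode 0)"] by simp
  then show ?thesis
    by (simp add: code_tl_def 0)
qed (auto simp: code_tl_def split: prod.split)

lemma list_decode_funpow_code_tl: "list_decode ((code_tl ^^ i) n) = drop i (list_decode n)"
  by (induction i) (auto simp: list_decode_code_tl drop_Suc tl_drop)

lemma list_decode_eq_Nil_iff: "list_decode n = [] \<longleftrightarrow> n = 0"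
  by (cases n) (auto split: prod.split)

text \<open>Only 0 codes the empty list, so a position is in range iff dropping that many entries
  leaves a nonzero code. Lengths are compared without being computed.\<close>

lemma less_length_list_decode_iff: "i < length (list_decode n) \<longleftrightarrow> (code_tl ^^ i) n \<noteq> 0"
  by (metis list_decode_eq_Nil_iff list_decode_funpow_code_tl drop_eq_Nil not_le)

lemma list_decode_nth: "i < length (list_decode n) \<Longrightarrow> list_decode n ! i = code_nth n i"
proof -
  assume i: "i < length (list_decode n)"
  then obtain m where m: "(code_tl ^^ i) n = Suc m"
    unfolding less_length_list_decode_iff using not0_implies_Suc by blast
  have "list_decode n ! i = hd (list_decode ((code_tl ^^ i) n))"
    unfolding list_decode_funpow_code_tl using i by (simp add: hd_drop_conv_nth)
  then show ?thesis
    by (simp add: m code_nth_def split: prod.split)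
qed

text \<open>Serves to bound sums and quantifiers over the positions of a list by its code.\<close>

lemma length_le_list_encode: "length xs \<le> list_encode xs"
proof (induction xs)
  case (Cons x xs)
  then show ?case
    using le_prod_encode_2[of "list_encode xs" x] by simp
qed simp

lemma member_le_list_encode: "x \<in> set xs \<Longrightarrow> x \<le> list_encode xs"
proof (induction xs)
  case (Cons y xs)
  then show ?case
    using le_prod_encode_2[of "list_encode xs" y] le_prod_encode_1[of y "list_encode xs"] by auto
qed simp

lemma length_list_decode_le: "length (list_decode n) \<le> n"
  using length_le_list_encode[of "list_decode n"] by simp

lemma rec_rel_less_length_list_decode:
  assumes "rec_fun B n f" "rec_fun B n g"
  shows "rec_rel B n (\<lambda>p ns. f p ns < length (list_decode (g p ns)))"
  unfolding less_length_list_decode_iff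
  by (intro rec_intros rec_fun_funpow_code_tl assms)

text \<open>The additional front argument is the bit position. Two kinds of points occur: the set
  variable itself, for the \<open>\<Pi>\<^sup>0\<^sub>3\<close> condition, and padded finite
  strings, for the Martin-Loef test.\<close>

definition rec_point :: "('p \<Rightarrow> nat \<Rightarrow> nat) set \<Rightarrow> nat \<Rightarrow> ('p \<Rightarrow> nat list \<Rightarrow> cantor) \<Rightarrow> bool" where
  "rec_point B n x \<longleftrightarrow> rec_rel B (Suc n) (\<lambda>p ns. x p (tl ns) (ns ! 0))"

lemma rec_point_tl:
  assumes "rec_point B n x"
  shows "rec_point B (Suc n) (\<lambda>p ns. x p (tl ns))"
  using assms unfolding rec_point_def by (rule rec_fun_skip_second)

lemma rec_point_oracle: "rec_point {\<lambda>x m. of_bool (x m)} n (\<lambda>p ns. p)"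
proof -
  have "recursive_fun {\<lambda>x m. of_bool (x m)} 1 (\<lambda>p ns. (\<lambda>x m. of_bool (x m)) p (ns ! 0))"
    by (rule initial) simp
  then have "rec_fun {\<lambda>x m. of_bool (x m)} 1 (\<lambda>p ns. of_bool (p (ns ! 0)))"
    unfolding rec_fun_def by auto
  then show ?thesis
    unfolding rec_point_def by (rule rec_fun_comp1) (simp add: rec_fun_nth)
qed

text \<open>Extending a string by zeros yields a member of its cylinder at which simple functions
  can be evaluated without an oracle.\<close>

definition pad :: "bool list \<Rightarrow> cantor" where
  "pad s m \<longleftrightarrow> m < length s \<and> s ! m"

lemma pad_string_of: "pad (string_of s) m \<longleftrightarrow> m < length (list_decode s) \<and> code_nth s m \<noteq> 0"
  by (auto simp: pad_def string_of_def list_decode_nth)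

lemma rec_point_pad:
  assumes "rec_fun B n f"
  shows "rec_point B n (\<lambda>p ns. pad (string_of (f p ns)))"
  unfolding rec_point_def pad_string_of
  by (intro rec_intros rec_rel_less_length_list_decode rec_fun_code_nth rec_fun_tl[OF assms])
    simp_all

text \<open>The length of a string is at most its code, so the quantifier over positions can be
  bounded by \<open>s\<close> itself.\<close>

lemma mem_cylinder_string_of_iff:
  "x \<in> cylinder (string_of s) \<longleftrightarrow>
     (\<forall>i<s. i < length (list_decode s) \<longrightarrow> (x i \<longleftrightarrow> code_nth s i \<noteq> 0))"
  using length_list_decode_le[of s]
  by (auto simp: cylinder_def string_of_def list_decode_nth)

lemma rec_rel_mem_cylinder:
  assumes "rec_fun B n f" "rec_point B n x"
  shows "rec_rel B n (\<lambda>p ns. x p ns \<in> cylinder (string_of (f p ns)))"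
  unfolding mem_cylinder_string_of_iff
  using assms(2) unfolding rec_point_def
  by (intro rec_intros rec_rel_less_length_list_decode rec_fun_code_nth rec_fun_tl[OF assms(1)]
      assms(1)) simp_all

subsection \<open>Recursive rational-valued functions\<close>

text \<open>A difference of two naturals as numerator accommodates both signs within recursive
  functions valued in the naturals.\<close>

definition rat_fun :: "('p \<Rightarrow> nat \<Rightarrow> nat) set \<Rightarrow> nat \<Rightarrow> ('p \<Rightarrow> nat list \<Rightarrow> real) \<Rightarrow> bool" where
  "rat_fun B n q \<longleftrightarrow> (\<exists>a b d. rec_fun B n a \<and> rec_fun B n b \<and> rec_fun B n d \<and>
     (\<forall>p ns. length ns = n \<longrightarrow> d p ns > 0 \<and>
        q p ns = (real (a p ns) - real (b p ns)) / real (d p ns)))"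

lemma rat_funI:
  assumes "rec_fun B n a" "rec_fun B n b" "rec_fun B n d"
    and "\<And>p ns. length ns = n \<Longrightarrow> d p ns > 0"
    and "\<And>p ns. length ns = n \<Longrightarrow> q p ns = (real (a p ns) - real (b p ns)) / real (d p ns)"
  shows "rat_fun B n q"
  using assms unfolding rat_fun_def by blast

lemma rat_funE:
  assumes "rat_fun B n q"
  obtains a b d where "rec_fun B n a" "rec_fun B n b" "rec_fun B n d"
    "\<And>p ns. length ns = n \<Longrightarrow> d p ns > 0"
    "\<And>p ns. length ns = n \<Longrightarrow> q p ns = (real (a p ns) - real (b p ns)) / real (d p ns)"
  using assms unfolding rat_fun_def by metis

lemma rat_fun_of_nat:
  assumes "rec_fun B n f"
  shows "rat_fun B n (\<lambda>p ns. real (f p ns))"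
  by (rule rat_funI[OF assms rec_fun_const[of B n 0] rec_fun_const[of B n 1]]) auto

lemma rat_fun_inverse_Suc:
  assumes "rec_fun B n f"
  shows "rat_fun B n (\<lambda>p ns. 1 / real (Suc (f p ns)))"
  by (rule rat_funI[OF rec_fun_const[of B n 1] rec_fun_const[of B n 0] rec_fun_Suc[OF assms]]) auto

lemma rat_fun_abs:
  assumes "rat_fun B n q"
  shows "rat_fun B n (\<lambda>p ns. \<bar>q p ns\<bar>)"
proof -
  obtain a b d where r: "rec_fun B n a" "rec_fun B n b" "rec_fun B n d"
    and d: "\<And>p ns. length ns = n \<Longrightarrow> d p ns > 0"
    and q: "\<And>p ns. length ns = n \<Longrightarrow> q p ns = (real (a p ns) - real (b p ns)) / real (d p ns)"
    using rat_funE[OF assms] by metis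
  \<comment> \<open>At least one of the two truncated differences is 0, and the other is the
    absolute value.\<close>
  have r': "rec_fun B n (\<lambda>p ns. (a p ns - b p ns) + (b p ns - a p ns))"
    by (intro rec_intros r)
  have eq: "\<bar>real i - real j\<bar> = real ((i - j) + (j - i))" for i j
    by (cases "i \<le> j") (auto simp: of_nat_diff)
  show ?thesis
    by (rule rat_funI[OF r' rec_fun_const[of B n 0] r(3) d])
      (simp_all add: q abs_divide eq del: of_nat_add)
qed

lemma rat_fun_diff:
  assumes "rat_fun B n q" "rat_fun B n q'"
  shows "rat_fun B n (\<lambda>p ns. q p ns - q' p ns)"
proof -
  obtain a b d where r: "rec_fun B n a" "rec_fun B n b" "rec_fun B n d"
    and d: "\<And>p ns. length ns = n \<Longrightarrow> d p ns > 0"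
    and q: "\<And>p ns. length ns = n \<Longrightarrow> q p ns = (real (a p ns) - real (b p ns)) / real (d p ns)"
    using rat_funE[OF assms(1)] by metis
  obtain a' b' d' where r': "rec_fun B n a'" "rec_fun B n b'" "rec_fun B n d'"
    and d': "\<And>p ns. length ns = n \<Longrightarrow> d' p ns > 0"
    and q': "\<And>p ns. length ns = n \<Longrightarrow> q' p ns = (real (a' p ns) - real (b' p ns)) / real (d' p ns)"
    using rat_funE[OF assms(2)] by metis
  show ?thesis
  proof (rule rat_funI)
    show "rec_fun B n (\<lambda>p ns. a p ns * d' p ns + b' p ns * d p ns)"
      "rec_fun B n (\<lambda>p ns. b p ns * d' p ns + a' p ns * d p ns)"
      "rec_fun B n (\<lambda>p ns. d p ns * d' p ns)"
      by (intro rec_intros r r')+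
    show "0 < d p ns * d' p ns" if "length ns = n" for p ns
      using d d' that by simp
    show "q p ns - q' p ns = (real (a p ns * d' p ns + b' p ns * d p ns) -
        real (b p ns * d' p ns + a' p ns * d p ns)) / real (d p ns * d' p ns)"
      if "length ns = n" for p ns
      using d[OF that, of p] d'[OF that, of p] by (simp add: q q' that field_simps)
  qed
qed

lemma rat_fun_restrict:
  assumes "rec_rel B n P" "rat_fun B n q"
  shows "rat_fun B n (\<lambda>p ns. if P p ns then q p ns else 0)"
proof -
  obtain a b d where r: "rec_fun B n a" "rec_fun B n b" "rec_fun B n d"
    and d: "\<And>p ns. length ns = n \<Longrightarrow> d p ns > 0"
    and q: "\<And>p ns. length ns = n \<Longrightarrow> q p ns = (real (a p ns) - real (b p ns)) / real (d p ns)"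
    using rat_funE[OF assms(2)] by metis
  have "rec_fun B n (\<lambda>p ns. of_bool (P p ns) * a p ns)"
    "rec_fun B n (\<lambda>p ns. of_bool (P p ns) * b p ns)"
    by (intro rec_intros r assms)+
  from this r(3) d show ?thesis
    by (rule rat_funI) (auto simp: q)
qed

text \<open>Denominators are positive, so the sign of \<open>q' - q\<close> is found by comparing
  two naturals.\<close>

lemma rec_rel_le_rat_fun:
  assumes "rat_fun B n q" "rat_fun B n q'"
  shows "rec_rel B n (\<lambda>p ns. q p ns \<le> q' p ns)"
proof -
  obtain a b d where r: "rec_fun B n a" "rec_fun B n b" "rec_fun B n d"
    and d: "\<And>p ns. length ns = n \<Longrightarrow> d p ns > 0"
    and q: "\<And>p ns. length ns = n \<Longrightarrow> q' p ns - q p ns = (real (a p ns) - real (b p ns)) / real (d p ns)"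
    using rat_funE[OF rat_fun_diff[OF assms(2,1)]] by metis
  have "rec_rel B n (\<lambda>p ns. b p ns \<le> a p ns)"
    by (intro rec_intros r)
  then show ?thesis
  proof (rule rec_fun_cong)
    fix p and ns :: "nat list"
    assume n: "length ns = n"
    have "q p ns \<le> q' p ns \<longleftrightarrow> 0 \<le> (real (a p ns) - real (b p ns)) / real (d p ns)"
      using q[OF n, of p] by linarith
    then show "of_bool (b p ns \<le> a p ns) = of_bool (q p ns \<le> q' p ns)"
      using d[OF n, of p] by (simp add: zero_le_divide_iff)
  qed
qed

text \<open>The cofactor of the \<open>y\<close>-th fraction is a product over the whole range with
  the \<open>y\<close>-th factor replaced by 1; in this form it is a bounded product of a recursive
  function.\<close>

lemma sum_divide_common_denominator:
  fixes a d :: "nat \<Rightarrow> real"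
  assumes "\<And>y. y < m \<Longrightarrow> d y \<noteq> 0"
  shows "(\<Sum>y<m. a y / d y) =
    (\<Sum>y<m. a y * (\<Prod>z<m. if z = y then 1 else d z)) / (\<Prod>z<m. d z)"
proof -
  have "a y / d y = a y * (\<Prod>z<m. if z = y then 1 else d z) / (\<Prod>z<m. d z)" if "y < m" for y
  proof -
    have "(\<Prod>z<m. if z = y then 1 else d z) = (\<Prod>z\<in>{..<m} - {y}. d z)"
      using that by (subst prod.remove[of _ y]) auto
    moreover have "(\<Prod>z<m. d z) = d y * (\<Prod>z\<in>{..<m} - {y}. d z)"
      using that by (subst prod.remove[of _ y]) auto
    moreover have "(\<Prod>z\<in>{..<m} - {y}. d z) \<noteq> 0"
      using assms by auto
    ultimately show ?thesis
      using assms[OF that] by simp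
  qed
  then show ?thesis
    by (simp add: sum_divide_distrib)
qed

lemma rat_fun_sum:
  assumes "rec_fun B n m" "rat_fun B (Suc n) (\<lambda>p ns. q p (tl ns) (ns ! 0))"
  shows "rat_fun B n (\<lambda>p ns. \<Sum>y<m p ns. q p ns y)"
proof -
  obtain a b d where r: "rec_fun B (Suc n) a" "rec_fun B (Suc n) b" "rec_fun B (Suc n) d"
    and d: "\<And>p ns. length ns = Suc n \<Longrightarrow> d p ns > 0"
    and q: "\<And>p ns. length ns = Suc n \<Longrightarrow>
      q p (tl ns) (ns ! 0) = (real (a p ns) - real (b p ns)) / real (d p ns)"
    using rat_funE[OF assms(2)] by metis
  have Cons: "rec_fun B (Suc n) (\<lambda>p ns. f p (ns ! 0 # tl ns))" if "rec_fun B (Suc n) f" for f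
    by (rule rec_fun_cong[OF that]) (auto simp: length_Suc_conv)
  have r': "rec_fun B (Suc n) (\<lambda>p ns. a p (ns ! 0 # tl ns))"
    "rec_fun B (Suc n) (\<lambda>p ns. b p (ns ! 0 # tl ns))"
    "rec_fun B (Suc n) (\<lambda>p ns. d p (ns ! 0 # tl ns))"
    by (intro Cons r)+
  \<comment> \<open>Inside the cofactor two variables are bound, \<open>z\<close> in front of
    \<open>y\<close>; the denominator is taken at \<open>z\<close>, so the second entry is
    skipped.\<close>
  have r'': "rec_fun B (Suc (Suc n)) (\<lambda>p ns. d p (ns ! 0 # tl (tl ns)))"
    by (rule rec_fun_skip_second[of B n "\<lambda>p ns y. d p (y # ns)"]) (rule r')
  let ?D = "\<lambda>p ns y. \<Prod>z<m p ns. if z = y then 1 else d p (z # ns)"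
  show ?thesis
  proof (rule rat_funI)
    show "rec_fun B n (\<lambda>p ns. \<Sum>y<m p ns. a p (y # ns) * ?D p ns y)"
      "rec_fun B n (\<lambda>p ns. \<Sum>y<m p ns. b p (y # ns) * ?D p ns y)"
      "rec_fun B n (\<lambda>p ns. \<Prod>y<m p ns. d p (y # ns))"
      by (intro rec_intros r' r'' assms rec_fun_tl[OF assms(1)]; simp)+
    fix p and ns :: "nat list"
    assume n: "length ns = n"
    show "0 < (\<Prod>y<m p ns. d p (y # ns))"
      using d n by (intro prod_pos) auto
    have "(\<Sum>y<m p ns. q p ns y) =
        (\<Sum>y<m p ns. (real (a p (y # ns)) - real (b p (y # ns))) / real (d p (y # ns)))"
      using q[of "_ # ns" p] n by (intro sum.cong) auto
    also have "\<dots> = (\<Sum>y<m p ns. (real (a p (y # ns)) - real (b p (y # ns))) *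
        (\<Prod>z<m p ns. if z = y then 1 else real (d p (z # ns)))) /
        (\<Prod>y<m p ns. real (d p (y # ns)))"
      using d[of "_ # ns" p] n by (intro sum_divide_common_denominator) auto
    also have "\<dots> = (\<Sum>y<m p ns. (real (a p (y # ns)) - real (b p (y # ns))) * real (?D p ns y)) /
        (\<Prod>y<m p ns. real (d p (y # ns)))"
      unfolding of_nat_prod by (simp add: if_distrib cong: if_cong)
    finally show "(\<Sum>y<m p ns. q p ns y) = (real (\<Sum>y<m p ns. a p (y # ns) * ?D p ns y) -
        real (\<Sum>y<m p ns. b p (y # ns) * ?D p ns y)) / real (\<Prod>y<m p ns. d p (y # ns))"
      by (simp only: of_nat_prod of_nat_sum of_nat_mult left_diff_distrib sum_subtractf)
  qed
qed

lemma rat_fun_rat_of: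
  assumes "rec_fun B n f"
  shows "rat_fun B n (\<lambda>p ns. of_rat (rat_of (f p ns)))"
proof (rule rat_funI)
  let ?p = "\<lambda>p ns. fst (prod_decode (f p ns))"
  \<comment> \<open>\<open>int_decode\<close> sends even \<open>m\<close> to \<open>m div 2\<close>
    and odd \<open>m\<close> to \<open>- (m div 2) - 1\<close>; these supply the two parts of the
    numerator.\<close>
  show "rec_fun B n (\<lambda>p ns. if even (?p p ns) then ?p p ns div 2 else 0)"
    "rec_fun B n (\<lambda>p ns. if even (?p p ns) then 0 else Suc (?p p ns div 2))"
    "rec_fun B n (\<lambda>p ns. Suc (snd (prod_decode (f p ns))))"
    by (intro rec_intros rec_rel_even rec_fun_div2 rec_fun_fst_prod_decode
        rec_fun_snd_prod_decode assms)+
qed (auto simp: rat_of_def int_decode_def sum_decode_def of_rat_divide of_rat_add of_rat_diff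
    of_rat_minus split: prod.split)

text \<open>The code bounds the length of the list, so the sum may run up to the code if a guard
  discards the positions out of range; \<open>rat_fun_sum\<close> and
  \<open>rat_fun_restrict\<close> apply to this form.\<close>

lemma simple_fun_terms_of:
  "simple_fun (terms_of c) x = (\<Sum>i<c. if i < length (list_decode c) \<and>
      x \<in> cylinder (string_of (snd (prod_decode (code_nth c i))))
      then of_rat (rat_of (fst (prod_decode (code_nth c i)))) else 0)"
proof -
  let ?h = "\<lambda>t. of_rat (rat_of (fst (prod_decode t))) *
      indicator (cylinder (string_of (snd (prod_decode t)))) x :: real"
  have "simple_fun (terms_of c) x = sum_list (map ?h (list_decode c))"
    by (simp add: simple_fun_def terms_of_def comp_def case_prod_unfold)
  also have "\<dots> = (\<Sum>i<length (list_decode c). ?h (list_decode c ! i))"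
    by (simp add: sum_list_sum_nth atLeast0LessThan)
  also have "\<dots> = (\<Sum>i<length (list_decode c). if i < length (list_decode c) \<and>
      x \<in> cylinder (string_of (snd (prod_decode (code_nth c i))))
      then of_rat (rat_of (fst (prod_decode (code_nth c i)))) else 0)"
    by (intro sum.cong) (auto simp: list_decode_nth)
  also have "\<dots> = (\<Sum>i<c. if i < length (list_decode c) \<and>
      x \<in> cylinder (string_of (snd (prod_decode (code_nth c i))))
      then of_rat (rat_of (fst (prod_decode (code_nth c i)))) else 0)"
    using length_list_decode_le[of c] by (intro sum.mono_neutral_left) auto
  finally show ?thesis .
qed

lemma rat_fun_simple_fun:
  assumes "rec_fun B n c" "rec_point B n x"
  shows "rat_fun B n (\<lambda>p ns. simple_fun (terms_of (c p ns)) (x p ns))"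
  unfolding simple_fun_terms_of
  by (intro rat_fun_sum rat_fun_restrict rat_fun_rat_of rec_intros rec_rel_mem_cylinder
      rec_rel_less_length_list_decode rec_fun_fst_prod_decode rec_fun_snd_prod_decode
      rec_fun_code_nth assms rec_fun_tl[OF assms(1)] rec_point_tl[OF assms(2)]) simp_all

text \<open>Every scheme generating functions without an oracle is available over \<open>B\<close>
  too; hence computable codes may be used in relations with a set variable.\<close>

lemma recursive_fun_lift:
  assumes "recursive_fun {} n (f :: unit \<Rightarrow> nat list \<Rightarrow> nat)"
  shows "recursive_fun B n (\<lambda>p. f ())"
  using assms
proof (induction rule: recursive_fun.induct)
  case (comp gs f n)
  have "recursive_fun B n (\<lambda>p ns. f () (map (\<lambda>g. g p ns) (map (\<lambda>g p. g ()) gs)))"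
    using comp by (intro recursive_fun.comp) auto
  then show ?case
    by (simp add: comp_def)
next
  case succ
  show ?case
    by (rule recursive_fun.succ)
qed (auto intro: recursive_fun.intros)

lemma computable2_iff_rec_fun:
  "computable2 c \<longleftrightarrow> rec_fun {} 2 (\<lambda>(p :: unit) ns. c (ns ! 0) (ns ! 1))"
proof -
  have "(\<forall>i k. c i k = f () [i, k]) \<longleftrightarrow>
      (\<forall>p ns. length ns = 2 \<longrightarrow> c (ns ! 0) (ns ! 1) = f p ns)" for f :: "unit \<Rightarrow> nat list \<Rightarrow> nat"
    by (auto simp: numeral_2_eq_2 length_Suc_conv) (metis nth_Cons_0 nth_Cons_Suc)
  then show ?thesis
    unfolding computable2_def rec_fun_def by simp
qed

lemma rec_fun_computable1:
  assumes "computable1 c" "rec_fun B n f"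
  shows "rec_fun B n (\<lambda>p ns. c (f p ns))"
proof -
  obtain h where h: "recursive_fun {} 1 h" "\<And>k. c k = h () [k]"
    using assms(1) unfolding computable1_def by blast
  have "rec_fun B 1 (\<lambda>p ns. c (ns ! 0))"
    unfolding rec_fun_def using recursive_fun_lift[OF h(1)]
    by (intro exI[of _ "\<lambda>p. h ()"]) (auto simp: h(2) length_Suc_conv)
  from rec_fun_comp1[OF this assms(2)] show ?thesis .
qed

lemma rec_fun_computable2:
  assumes "computable2 c" "rec_fun B n f" "rec_fun B n g"
  shows "rec_fun B n (\<lambda>p ns. c (f p ns) (g p ns))"
proof -
  obtain h where h: "recursive_fun {} 2 h" "\<And>i k. c i k = h () [i, k]"
    using assms(1) unfolding computable2_def by blast
  have "rec_fun B 2 (\<lambda>p ns. c (ns ! 0) (ns ! 1))"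
    unfolding rec_fun_def using recursive_fun_lift[OF h(1)]
    by (intro exI[of _ "\<lambda>p. h ()"]) (auto simp: h(2) length_Suc_conv numeral_2_eq_2)
  from rec_fun_comp2[OF this assms(2,3)] show ?thesis .
qed


subsection \<open>The Martin-Loef test\<close>

lemma prob_space_coin_measure: "prob_space coin_measure"
  unfolding coin_measure_def by (intro prob_space_PiM measure_pmf.prob_space_axioms)

lemma space_coin_measure: "space coin_measure = UNIV"
  by (simp add: coin_measure_def space_PiM)

lemma sets_cylinder: "cylinder s \<in> sets coin_measure"
proof -
  have "cylinder s =
      prod_emb UNIV (\<lambda>_. measure_pmf (bernoulli_pmf (1/2))) {..<length s}
        (Pi\<^sub>E {..<length s} (\<lambda>i. {s ! i}))"
    by (auto simp: cylinder_def prod_emb_def PiE_def Pi_def)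
  then show ?thesis
    unfolding coin_measure_def by (simp add: sets_PiM_I)
qed

lemma integrable_simple_fun: "integrable coin_measure (simple_fun ts)"
proof -
  interpret prob_space coin_measure by (rule prob_space_coin_measure)
  have "integrable coin_measure (\<lambda>x. \<Sum>(a, s)\<leftarrow>ts. of_rat a * indicator (cylinder s) x :: real)"
  proof (induction ts)
    case (Cons t ts)
    then show ?case
      using sets_cylinder[of "snd t"]
      by (auto simp: case_prod_unfold less_top[symmetric]
          intro!: Bochner_Integration.integrable_add integrable_mult_right integrable_real_indicator)
  qed simp
  then show ?thesis
    by (simp add: simple_fun_def[abs_def])
qed

text \<open>A finite square part of a double series. Row \<open>i\<close> starts at the
  \<open>i\<close>-th approximation, so for names its integral is of order \<open>(1/2) ^ i\<close>
  and the rows are summable.\<close>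

definition variation :: "(nat \<Rightarrow> nat \<Rightarrow> cantor \<Rightarrow> real) \<Rightarrow> nat \<Rightarrow> cantor \<Rightarrow> real" where
  "variation F n x = (\<Sum>i<n. \<Sum>k<n. \<bar>F i (Suc (i + k)) x - F i (i + k) x\<bar>)"

lemma variation_nonneg: "0 \<le> variation F n x"
  unfolding variation_def by (intro sum_nonneg) auto

lemma sum_le_variation:
  assumes "m \<le> n" "m' \<le> n"
  shows "(\<Sum>i<m. \<Sum>k<m'. \<bar>F i (Suc (i + k)) x - F i (i + k) x\<bar>) \<le> variation F n x"
proof -
  have "(\<Sum>i<m. \<Sum>k<m'. \<bar>F i (Suc (i + k)) x - F i (i + k) x\<bar>) \<le>
      (\<Sum>i<m. \<Sum>k<n. \<bar>F i (Suc (i + k)) x - F i (i + k) x\<bar>)"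
    using assms by (intro sum_mono sum_mono2) auto
  also have "\<dots> \<le> variation F n x"
    unfolding variation_def using assms by (intro sum_mono2) (auto intro: sum_nonneg)
  finally show ?thesis .
qed

lemma variation_mono: "m \<le> n \<Longrightarrow> variation F m x \<le> variation F n x"
  unfolding variation_def[of F m] by (rule sum_le_variation)

lemma sum_half_powers_le: "(\<Sum>k<n. (1/2) ^ k) \<le> (2 :: real)"
proof -
  have "(\<Sum>k<n. (1/2) ^ k) = 2 - 2 * (1/2 :: real) ^ n"
    by (induction n) auto
  then show ?thesis by simp
qed

lemma integral_variation_le:
  assumes "\<And>i. L1_name (F i)"
  shows "integrable coin_measure (variation F n)" "(\<integral>x. variation F n x \<partial>coin_measure) \<le> 4"
proof -
  have "integrable coin_measure (F i k)" for i k
    using assms[of i] integrable_simple_fun unfolding L1_name_def by (metis rangeE)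
  then have int: "integrable coin_measure (\<lambda>x. \<bar>F i k x - F i l x\<bar>)" for i k l
    by (intro integrable_abs Bochner_Integration.integrable_diff)
  then show "integrable coin_measure (variation F n)"
    unfolding variation_def[abs_def] by (intro Bochner_Integration.integrable_sum)
  have small: "(\<integral>x. \<bar>F i (Suc (i + k)) x - F i (i + k) x\<bar> \<partial>coin_measure) \<le> (1/2) ^ (i + k)" for i k
  proof -
    have "L1_norm (\<lambda>x. F i (i + k) x - F i (Suc (i + k)) x) < (1/2) ^ (i + k)"
      using assms[of i] unfolding L1_name_def by simp
    then show ?thesis
      unfolding L1_norm_def by (subst abs_minus_commute) simp
  qed
  have "(\<integral>x. variation F n x \<partial>coin_measure) =
      (\<Sum>i<n. \<Sum>k<n. \<integral>x. \<bar>F i (Suc (i + k)) x - F i (i + k) x\<bar> \<partial>coin_measure)"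
    unfolding variation_def
    by (simp add: int Bochner_Integration.integral_sum Bochner_Integration.integrable_sum)
  also have "\<dots> \<le> (\<Sum>i<n. \<Sum>k<n. (1/2) ^ (i + k))"
    by (intro sum_mono small)
  \<comment> \<open>The double sum factors into two geometric sums, each at most 2, whence the
    constant 4.\<close>
  also have "\<dots> = (\<Sum>i<n. (1/2) ^ i) * (\<Sum>k<n. (1/2) ^ k)"
    by (simp add: power_add sum_product)
  also have "\<dots> \<le> 2 * 2"
    by (intro mult_mono sum_half_powers_le sum_nonneg) auto
  finally show "(\<integral>x. variation F n x \<partial>coin_measure) \<le> 4"
    by simp
qed

text \<open>Markov's inequality gives the bound for each \<open>n\<close>; the sets increase with
  \<open>n\<close>, so continuity from below carries it to their union.\<close>

lemma measure_variation_gt: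
  assumes "\<And>i. L1_name (F i)" "0 < t"
  shows "measure coin_measure {x. \<exists>n. t < variation F n x} \<le> 4 / t"
proof -
  interpret prob_space coin_measure by (rule prob_space_coin_measure)
  let ?A = "\<lambda>n. {x. t < variation F n x}"
  have meas[measurable]: "variation F n \<in> borel_measurable coin_measure" for n
    using integral_variation_le(1)[OF assms(1)] by auto
  have sets: "?A n \<in> sets coin_measure" for n
    using borel_measurable_less[OF borel_measurable_const meas, of t n]
    by (simp add: space_coin_measure)
  have bound: "measure coin_measure (?A n) \<le> 4 / t" for n
  proof -
    have "measure coin_measure (?A n) \<le>
        measure coin_measure {x \<in> space coin_measure. variation F n x \<ge> t}"
    proof (rule finite_measure_mono)
      show "{x \<in> space coin_measure. variation F n x \<ge> t} \<in> sets coin_measure"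
        by measurable
    qed (auto simp: space_coin_measure)
    also have "\<dots> \<le> (\<integral>x. variation F n x \<partial>coin_measure) / t"
      using integral_variation_le(1)[OF assms(1), where n = n] assms(2)
      by (intro integral_Markov_inequality_measure[where A = "space coin_measure"])
        (auto simp: variation_nonneg)
    also have "\<dots> \<le> 4 / t"
      using integral_variation_le(2)[OF assms(1), where n = n] assms(2)
      by (intro divide_right_mono) auto
    finally show ?thesis .
  qed
  have "(\<lambda>n. measure coin_measure (?A n)) \<longlonglongrightarrow> measure coin_measure (\<Union>n. ?A n)"
    using sets variation_mono[of _ _ F]
    by (intro finite_Lim_measure_incseq) (auto intro!: incseq_SucI intro: less_le_trans)
  moreover have "(\<Union>n. ?A n) = {x. \<exists>n. t < variation F n x}"
    by auto
  ultimately show ?thesis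
    using bound by (metis (no_types, lifting) LIMSEQ_le_const2)
qed

text \<open>A code is at least as large as each entry of its list, and the string in an entry is no
  longer than that entry; so evaluation consults only bits below \<open>c\<close>.\<close>

lemma simple_fun_terms_of_cong:
  assumes "\<And>m. m < c \<Longrightarrow> x m = y m"
  shows "simple_fun (terms_of c) x = simple_fun (terms_of c) y"
proof -
  have "indicator (cylinder (snd t)) x = (indicator (cylinder (snd t)) y :: real)"
    if t: "t \<in> set (terms_of c)" for t
  proof -
    obtain u where u: "u \<in> set (list_decode c)" "snd t = string_of (snd (prod_decode u))"
      using t by (auto simp: terms_of_def case_prod_unfold)
    have "length (snd t) \<le> snd (prod_decode u)"
      using length_list_decode_le by (simp add: u(2) string_of_def)
    also have "\<dots> \<le> u"
      using le_prod_encode_2[of "snd (prod_decode u)" "fst (prod_decode u)"] by simp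
    also have "u \<le> c"
      using member_le_list_encode[OF u(1)] by simp
    finally show ?thesis
      using assms by (auto simp: indicator_def cylinder_def)
  qed
  then show ?thesis
    unfolding simple_fun_def by (intro arg_cong[of _ _ sum_list] map_cong) (auto split: prod.split)
qed

text \<open>
  Membership of \<open>x\<close> in the \<open>m\<close>-th test set depends on a finite part of \<open>x\<close> whose length is
  bounded by the codes of the simple functions involved, as no number exceeds a code of a list containing it.
\<close>

lemma uniformly_Sigma01_variation_gt:
  assumes c: "computable2 c" and F: "\<And>i k. F i k = simple_fun (terms_of (c i k))"
  shows "uniformly_Sigma01 (\<lambda>m. {x. \<exists>n. 2 ^ (m + 3) < variation F n x})"
proof -
  \<comment> \<open>The index \<open>k\<close> runs up to \<open>n\<close> inclusive because the
    differences also involve \<open>Suc (i + k)\<close> with \<open>k < n\<close>. A sum of codes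
    dominates each of them and is visibly recursive.\<close>
  define use where "use n = (\<Sum>i<n. \<Sum>k<Suc n. c i (i + k))" for n
  have code_le_use: "c i (i + k) \<le> use n" if "i < n" "k \<le> n" for i k n
  proof -
    have "c i (i + k) \<le> (\<Sum>k<Suc n. c i (i + k))"
      using that by (intro member_le_sum) auto
    also have "\<dots> \<le> use n"
      unfolding use_def using that by (intro member_le_sum[of i]) auto
    finally show ?thesis .
  qed
  have variation_cong: "variation F n x = variation F n y" if "\<And>m. m < use n \<Longrightarrow> x m = y m" for n x y
  proof -
    have "F i (i + k) x = F i (i + k) y" if "i < n" "k \<le> n" for i k
      unfolding F using code_le_use[OF that] \<open>\<And>m. m < use n \<Longrightarrow> x m = y m\<close>
      by (intro simple_fun_terms_of_cong) auto
    from this[of _ "Suc _"] this show ?thesis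
      unfolding variation_def by (intro sum.cong) auto
  qed
  \<comment> \<open>The number \<open>j\<close> codes a stage \<open>n\<close> and a string
    \<open>s\<close>. The cylinder of \<open>s\<close> is listed if \<open>s\<close> is long enough
    to determine stage \<open>n\<close> and its padding exceeds the threshold; the value 0 lists the
    empty set.\<close>
  define b where "b m j = (let n = fst (prod_decode j); s = snd (prod_decode j) in
      if (\<forall>l<use n. l < length (list_decode s)) \<and>
        \<not> variation F n (pad (string_of s)) \<le> real (2 ^ (m + 3)) then Suc s else 0)" for m j
  have "rec_fun {} 2 (\<lambda>(p :: unit) ns. b (ns ! 0) (ns ! 1))"
    unfolding b_def Let_def variation_def F use_def
    by (intro rec_intros rat_fun_of_nat rec_rel_le_rat_fun rat_fun_sum rat_fun_abs rat_fun_diff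
        rat_fun_simple_fun rec_point_pad rec_fun_computable2[OF c]
        rec_rel_less_length_list_decode rec_fun_fst_prod_decode rec_fun_snd_prod_decode) simp_all
  then have "computable2 b"
    by (simp add: computable2_iff_rec_fun)
  moreover have "{x. \<exists>n. 2 ^ (m + 3) < variation F n x} = (\<Union>j. basic_open (b m j))" for m
  proof (intro equalityI subsetI)
    fix x
    assume "x \<in> {x. \<exists>n. 2 ^ (m + 3) < variation F n x}"
    then obtain n where n: "2 ^ (m + 3) < variation F n x"
      by blast
    \<comment> \<open>The witness is the initial segment of \<open>x\<close> on which stage
      \<open>n\<close> can depend.\<close>
    obtain s where s: "string_of s = map x [0..<use n]"
      using surj_string_of by (metis surjD)
    have "length (list_decode s) = use n"
      using arg_cong[OF s, of length] by (simp add: string_of_def)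
    moreover have "variation F n (pad (string_of s)) = variation F n x"
      by (intro variation_cong) (simp add: pad_def s)
    ultimately have "b m (prod_encode (n, s)) = Suc s"
      using n by (simp add: b_def)
    moreover have "x \<in> cylinder (string_of s)"
      by (simp add: cylinder_def s)
    ultimately have "x \<in> basic_open (b m (prod_encode (n, s)))"
      by simp
    then show "x \<in> (\<Union>j. basic_open (b m j))"
      by blast
  next
    fix x
    assume "x \<in> (\<Union>j. basic_open (b m j))"
    then obtain j where j: "x \<in> basic_open (b m j)"
      by blast
    define n s where "n = fst (prod_decode j)" and "s = snd (prod_decode j)"
    have use: "\<forall>l<use n. l < length (list_decode s)"
      and gt: "\<not> variation F n (pad (string_of s)) \<le> real (2 ^ (m + 3))"
      and x: "x \<in> cylinder (string_of s)"
      using j by (auto simp: b_def Let_def n_def s_def split: if_splits)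
    \<comment> \<open>The string has at least \<open>use n\<close> bits, so \<open>x\<close>, which
      extends it, agrees with the padding below \<open>use n\<close>.\<close>
    have "variation F n x = variation F n (pad (string_of s))"
      using use x by (intro variation_cong) (auto simp: pad_def cylinder_def string_of_def)
    then show "x \<in> {x. \<exists>n. 2 ^ (m + 3) < variation F n x}"
      using gt by (auto intro!: exI[of _ n])
  qed
  ultimately show ?thesis
    unfolding uniformly_Sigma01_def by blast
qed

lemma martin_loef_null_variation_unbounded:
  assumes "uniformly_computable_names F" "\<And>i. L1_name (F i)"
  shows "martin_loef_null (\<Inter>m. {x. \<exists>n. 2 ^ (m + 3) < variation F n x})"
proof -
  obtain c where c: "computable2 c" "\<And>i k. F i k = simple_fun (terms_of (c i k))"
    using assms(1) unfolding uniformly_computable_names_def by blast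
  have "measure coin_measure {x. \<exists>n. 2 ^ (m + 3) < variation F n x} < (1/2) ^ m" for m
  proof -
    have "measure coin_measure {x. \<exists>n. 2 ^ (m + 3) < variation F n x} \<le> 4 / 2 ^ (m + 3)"
      by (intro measure_variation_gt assms(2)) simp
    \<comment> \<open>The left side equals \<open>(1/2) ^ (m + 1)\<close>: the exponent
      \<open>m + 3\<close> absorbs the constant 4 and leaves a factor 2 for strictness.\<close>
    also have "\<dots> < (1/2) ^ m"
      by (simp add: power_add power_divide field_simps)
    finally show ?thesis .
  qed
  then have "martin_loef_test (\<lambda>m. {x. \<exists>n. 2 ^ (m + 3) < variation F n x})"
    unfolding martin_loef_test_def using uniformly_Sigma01_variation_gt[OF c] by blast
  then show ?thesis
    unfolding martin_loef_null_def by blast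
qed

subsection \<open>Convergence outside the null set\<close>

text \<open>For fixed \<open>i\<close> the increments from index \<open>i\<close> on are absolutely
  summable, and their sum is the limit minus \<open>F i i x\<close>. The absolute row sums form a
  convergent series, hence tend to 0 and dominate these differences.\<close>

lemma variation_bounded_imp:
  assumes C: "\<And>n. variation F n x \<le> C"
  shows "defined_at (F i) x" "(\<lambda>i. value_at (F i) x - F i i x) \<longlonglongrightarrow> 0"
proof -
  define d where "d i k = F i (Suc (i + k)) x - F i (i + k) x" for i k
  have sum_C: "(\<Sum>i<m. \<Sum>k<n. \<bar>d i k\<bar>) \<le> C" for m n
    using sum_le_variation[of m "max m n" n F x] C[of "max m n"] by (simp add: d_def)
  have "(\<Sum>k<n. \<bar>d i k\<bar>) \<le> C" for i n
  proof -
    have "(\<Sum>k<n. \<bar>d i k\<bar>) \<le> (\<Sum>i<Suc i. \<Sum>k<n. \<bar>d i k\<bar>)"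
      by (rule member_le_sum[of i "{..<Suc i}" "\<lambda>i. \<Sum>k<n. \<bar>d i k\<bar>"]) (auto intro: sum_nonneg)
    also note sum_C
    finally show ?thesis .
  qed
  then have abs_summable: "summable (\<lambda>k. \<bar>d i k\<bar>)" for i
    by (intro summableI_nonneg_bounded) auto
  have lim: "(\<lambda>k. F i k x) \<longlonglongrightarrow> F i i x + suminf (d i)" for i
  proof (rule LIMSEQ_offset[of _ i])
    have "F i (k + i) x = F i i x + (\<Sum>l<k. d i l)" for k
      unfolding d_def using sum_lessThan_telescope[of "\<lambda>l. F i (i + l) x" k]
      by (simp add: add.commute)
    moreover have "(\<lambda>k. F i i x + (\<Sum>l<k. d i l)) \<longlonglongrightarrow> F i i x + suminf (d i)"
      using summable_rabs_cancel[OF abs_summable]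
      by (intro tendsto_add tendsto_const summable_LIMSEQ)
    ultimately show "(\<lambda>k. F i (k + i) x) \<longlonglongrightarrow> F i i x + suminf (d i)"
      by simp
  qed
  then show "defined_at (F i) x"
    unfolding defined_at_def convergent_def by blast
  \<comment> \<open>With the number of rows fixed, the length of the rows tends to infinity in
    \<open>sum_C\<close>.\<close>
  have "(\<Sum>i<m. \<Sum>k. \<bar>d i k\<bar>) \<le> C" for m
    using sum_C by (intro LIMSEQ_le_const2[OF tendsto_sum[OF summable_LIMSEQ[OF abs_summable]]]) blast
  then have "summable (\<lambda>i. \<Sum>k. \<bar>d i k\<bar>)"
    using suminf_nonneg[OF abs_summable] by (intro summableI_nonneg_bounded[of _ C]) auto
  then have A: "(\<lambda>i. \<Sum>k. \<bar>d i k\<bar>) \<longlonglongrightarrow> 0"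
    by (rule summable_LIMSEQ_zero)
  have "value_at (F i) x - F i i x = suminf (d i)" for i
    unfolding value_at_def limI[OF lim[of i]] by simp
  then have "norm (value_at (F i) x - F i i x) \<le> (\<Sum>k. \<bar>d i k\<bar>)" for i
    using summable_rabs[OF abs_summable[of i]] by simp
  then show "(\<lambda>i. value_at (F i) x - F i i x) \<longlonglongrightarrow> 0"
    by (intro Lim_null_comparison[OF _ A] always_eventually allI)
qed

text \<open>This is the Cauchy criterion with a single pivot \<open>u j\<close> and reciprocals of
  naturals as precisions, so that all three quantifiers range over numbers in the order that
  \<open>Pi0_set_3_iff\<close> asks for.\<close>

lemma convergent_iff_Cauchy_inverse_Suc:
  fixes u :: "nat \<Rightarrow> real"
  shows "convergent u \<longleftrightarrow> (\<forall>e. \<exists>j. \<forall>k. \<bar>u (j + k) - u j\<bar> \<le> 1 / real (Suc e))"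
proof
  assume "convergent u"
  then have "Cauchy u"
    by (simp add: Cauchy_convergent_iff)
  show "\<forall>e. \<exists>j. \<forall>k. \<bar>u (j + k) - u j\<bar> \<le> 1 / real (Suc e)"
  proof
    fix e :: nat
    have "0 < 1 / real (Suc e)"
      by simp
    from metric_CauchyD[OF \<open>Cauchy u\<close> this] obtain M where
      "\<forall>m\<ge>M. \<forall>n\<ge>M. dist (u m) (u n) < 1 / real (Suc e)"
      by blast
    then show "\<exists>j. \<forall>k. \<bar>u (j + k) - u j\<bar> \<le> 1 / real (Suc e)"
      by (intro exI[of _ M]) (auto simp: dist_real_def intro!: less_imp_le)
  qed
next
  assume R: "\<forall>e. \<exists>j. \<forall>k. \<bar>u (j + k) - u j\<bar> \<le> 1 / real (Suc e)"
  have "Cauchy u"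
  proof (rule metric_CauchyI)
    fix r :: real
    assume "0 < r"
    \<comment> \<open>Two terms past the pivot differ by at most twice the precision, hence
      \<open>r / 2\<close>.\<close>
    then obtain e where e: "1 / real (Suc e) < r / 2"
      using nat_approx_posE[of "r / 2"] by auto
    obtain j where j: "\<And>k. \<bar>u (j + k) - u j\<bar> \<le> 1 / real (Suc e)"
      using R by blast
    have "dist (u m) (u n) < r" if "j \<le> m" "j \<le> n" for m n
      using j[of "m - j"] j[of "n - j"] e that by (auto simp: dist_real_def)
    then show "\<exists>M. \<forall>m\<ge>M. \<forall>n\<ge>M. dist (u m) (u n) < r"
      by blast
  qed
  then show "convergent u"
    by (simp add: Cauchy_convergent_iff)
qed

lemma Pi0_set_convergent_diagonal:
  assumes "uniformly_computable_names F"
  shows "Pi0_set 3 {x. convergent (\<lambda>i. F i i x)}"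
proof -
  obtain c where c: "computable2 c" and F: "\<And>i k. F i k = simple_fun (terms_of (c i k))"
    using assms unfolding uniformly_computable_names_def by blast
  \<comment> \<open>The innermost variable comes first: entries 0, 1 and 2 are the offset, the pivot
    and the precision.\<close>
  let ?R = "\<lambda>x ns. \<bar>F (ns ! 1 + ns ! 0) (ns ! 1 + ns ! 0) x - F (ns ! 1) (ns ! 1) x\<bar> \<le>
      1 / real (Suc (ns ! 2))"
  have "rec_rel {\<lambda>x m. of_bool (x m)} 3 ?R"
    unfolding F
    by (intro rec_rel_le_rat_fun rat_fun_abs rat_fun_diff rat_fun_simple_fun rat_fun_inverse_Suc
        rec_point_oracle rec_fun_computable2[OF c] rec_intros) simp_all
  then have "computable_rel 3 ?R"
    unfolding computable_rel_def rec_fun_def by metis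
  moreover have "{x. convergent (\<lambda>i. F i i x)} = {x. \<forall>i. \<exists>j. \<forall>k. ?R x [k, j, i]}"
    by (simp add: convergent_iff_Cauchy_inverse_Suc)
  ultimately show ?thesis
    unfolding Pi0_set_3_iff by blast
qed

lemma convergence_set_agrees_with_Pi0_3:
  assumes "uniformly_computable_names F" "\<And>i. L1_name (F i)"
  shows "\<exists>P N. Pi0_set 3 P \<and> martin_loef_null N \<and> agree_outside N
    {x. (\<forall>i. defined_at (F i) x) \<and> convergent (\<lambda>i. value_at (F i) x)} P"
proof (intro exI conjI)
  show "Pi0_set 3 {x. convergent (\<lambda>i. F i i x)}"
    by (rule Pi0_set_convergent_diagonal[OF assms(1)])
  let ?N = "\<Inter>m. {x. \<exists>n. 2 ^ (m + 3) < variation F n x}"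
  show "martin_loef_null ?N"
    by (rule martin_loef_null_variation_unbounded[OF assms])
  have "((\<forall>i. defined_at (F i) x) \<and> convergent (\<lambda>i. value_at (F i) x)) \<longleftrightarrow>
      convergent (\<lambda>i. F i i x)" if x: "x \<notin> ?N" for x
  proof -
    obtain m where "\<And>n. variation F n x \<le> 2 ^ (m + 3)"
      using x by (auto simp: not_less)
    note bounded = variation_bounded_imp[OF this]
    have diff: "convergent (\<lambda>i. value_at (F i) x - F i i x)"
      using bounded(2) by (rule convergentI)
    have "convergent (\<lambda>i. value_at (F i) x) \<longleftrightarrow> convergent (\<lambda>i. F i i x)"
    proof
      assume "convergent (\<lambda>i. value_at (F i) x)"
      then have "convergent (\<lambda>i. value_at (F i) x - (value_at (F i) x - F i i x))"
        using diff by (rule convergent_diff)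
      then show "convergent (\<lambda>i. F i i x)"
        by simp
    next
      assume "convergent (\<lambda>i. F i i x)"
      then have "convergent (\<lambda>i. F i i x + (value_at (F i) x - F i i x))"
        using diff by (rule convergent_add)
      then show "convergent (\<lambda>i. value_at (F i) x)"
        by simp
    qed
    with bounded(1) show ?thesis
      by blast
  qed
  then show "agree_outside ?N {x. (\<forall>i. defined_at (F i) x) \<and> convergent (\<lambda>i. value_at (F i) x)}
      {x. convergent (\<lambda>i. F i i x)}"
    unfolding agree_outside_def by blast
qed

text \<open>The odd terms are constantly \<open>l\<close>, so the only possible limit is
  \<open>l\<close>; the even terms are \<open>u\<close> itself.\<close>

lemma convergent_interleave_iff:
  fixes u :: "nat \<Rightarrow> real"
  shows "convergent (\<lambda>i. if even i then u (i div 2) else l) \<longleftrightarrow> u \<longlonglongrightarrow> l"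
proof
  let ?v = "\<lambda>i. if even i then u (i div 2) else l"
  assume "convergent ?v"
  then obtain L where L: "?v \<longlonglongrightarrow> L"
    unfolding convergent_def by blast
  have "strict_mono (\<lambda>i::nat. 2 * i)" "strict_mono (\<lambda>i::nat. Suc (2 * i))"
    by (auto intro: strict_monoI)
  from LIMSEQ_subseq_LIMSEQ[OF L this(1)] LIMSEQ_subseq_LIMSEQ[OF L this(2)]
  have "u \<longlonglongrightarrow> L" "(\<lambda>i::nat. l) \<longlonglongrightarrow> L"
    by (simp_all add: comp_def)
  then show "u \<longlonglongrightarrow> l"
    by (metis LIMSEQ_const_iff)
next
  let ?v = "\<lambda>i. if even i then u (i div 2) else l"
  assume u: "u \<longlonglongrightarrow> l"
  have "?v \<longlonglongrightarrow> l"
  proof (rule LIMSEQ_I)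
    fix r :: real
    assume r: "0 < r"
    with LIMSEQ_D[OF u] obtain n0 where "\<forall>n\<ge>n0. norm (u n - l) < r"
      by blast
    then show "\<exists>no. \<forall>n\<ge>no. norm (?v n - l) < r"
      using r by (intro exI[of _ "2 * n0"]) auto
  qed
  then show "convergent ?v"
    unfolding convergent_def by blast
qed

lemma uniformly_computable_names_interleave:
  assumes "uniformly_computable_names F" "computable_name H"
  shows "uniformly_computable_names (\<lambda>i. if even i then F (i div 2) else H)"
proof -
  obtain c where c: "computable2 c" "\<And>i k. F i k = simple_fun (terms_of (c i k))"
    using assms(1) unfolding uniformly_computable_names_def by blast
  obtain d where d: "computable1 d" "\<And>k. H k = simple_fun (terms_of (d k))"
    using assms(2) unfolding computable_name_def by blast
  have "rec_fun {} 2 (\<lambda>(p :: unit) ns. if even (ns ! 0) then c (ns ! 0 div 2) (ns ! 1) else d (ns ! 1))"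
    by (intro rec_fun_if rec_rel_even rec_fun_div2 rec_fun_computable2[OF c(1)]
        rec_fun_computable1[OF d(1)] rec_fun_nth) simp_all
  then have "computable2 (\<lambda>i k. if even i then c (i div 2) k else d k)"
    by (simp only: computable2_iff_rec_fun)
  then show ?thesis
    unfolding uniformly_computable_names_def using c(2) d(2)
    by (intro exI[of _ "\<lambda>i k. if even i then c (i div 2) k else d k"]) auto
qed

theorem theorem2p1:
  fixes f :: "nat \<Rightarrow> cantor \<Rightarrow> real"
    and F :: "nat \<Rightarrow> nat \<Rightarrow> cantor \<Rightarrow> real"
  assumes "\<forall>i. L1_name_of (F i) (f i)"
    and "uniformly_computable_names F"
  shows "(\<exists>P N. Pi0_set 3 P \<and> martin_loef_null N \<and>
            agree_outside N
              {x. (\<forall>i. defined_at (F i) x) \<and> convergent (\<lambda>i. value_at (F i) x)} P) \<and>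
         (\<forall>h H. L1_name_of H h \<and> computable_name H \<longrightarrow>
            (\<exists>P' N'. Pi0_set 3 P' \<and> martin_loef_null N' \<and>
              agree_outside N'
                {x. (\<forall>i. defined_at (F i) x) \<and> defined_at H x \<and>
                    (\<lambda>i. value_at (F i) x) \<longlonglongrightarrow> value_at H x} P'))"
proof (intro conjI allI impI)
  have name: "L1_name (F i)" for i
    using assms(1) unfolding L1_name_of_def by blast
  show "\<exists>P N. Pi0_set 3 P \<and> martin_loef_null N \<and> agree_outside N
      {x. (\<forall>i. defined_at (F i) x) \<and> convergent (\<lambda>i. value_at (F i) x)} P"
    by (rule convergence_set_agrees_with_Pi0_3[OF assms(2) name])
  fix h H
  assume H: "L1_name_of H h \<and> computable_name H"
  \<comment> \<open>Interleaving turns convergence to a prescribed limit into plain convergence, to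
    which the first half applies. Since \<open>H\<close> is itself a term of the sequence,
    definedness of all terms includes that of \<open>H\<close> at \<open>x\<close>.\<close>
  define G where "G i = (if even i then F (i div 2) else H)" for i :: nat
  have "uniformly_computable_names G"
    unfolding G_def[abs_def] using H by (intro uniformly_computable_names_interleave assms(2)) blast
  moreover have "L1_name (G i)" for i
    using H name by (auto simp: G_def L1_name_of_def)
  ultimately have "\<exists>P N. Pi0_set 3 P \<and> martin_loef_null N \<and> agree_outside N
      {x. (\<forall>i. defined_at (G i) x) \<and> convergent (\<lambda>i. value_at (G i) x)} P"
    by (rule convergence_set_agrees_with_Pi0_3)
  moreover have "(\<forall>i. defined_at (G i) x) \<longleftrightarrow> (\<forall>i. defined_at (F i) x) \<and> defined_at H x" for x
  proof -
    have "G (2 * i) = F i" "G (Suc (2 * i)) = H" for i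
      by (simp_all add: G_def)
    then show ?thesis
      by (metis G_def)
  qed
  moreover have "convergent (\<lambda>i. value_at (G i) x) \<longleftrightarrow> (\<lambda>i. value_at (F i) x) \<longlonglongrightarrow> value_at H x" for x
  proof -
    have "value_at (G i) x = (if even i then value_at (F (i div 2)) x else value_at H x)" for i
      by (simp add: G_def)
    then show ?thesis
      using convergent_interleave_iff[of "\<lambda>i. value_at (F i) x" "value_at H x"] by simp
  qed
  ultimately show "\<exists>P' N'. Pi0_set 3 P' \<and> martin_loef_null N' \<and> agree_outside N'
      {x. (\<forall>i. defined_at (F i) x) \<and> defined_at H x \<and>
          (\<lambda>i. value_at (F i) x) \<longlonglongrightarrow> value_at H x} P'"
    by (simp add: conj_assoc)
qed

end
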